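(* There exists an absolute constant $c>0$ such that, for arbitrarily large $s$, one can find an $s$-point set $X\subset B_1(0)\subset\mathbb R^3$ and a wavenumber $\kappa>0$ satisfying $$\kappa\delta_X\asymp s^{2/3}$$ (with absolute implied constants) and $$\max_{x\in X}\sum_{y\in X,\,y\ne x}|K_\kappa(x-y)|\ge c .$$ More generally, the exponent $2/3$ cannot be replaced by any $p<2/3$ in a uniform estimate of the form $$\max_{x\in X}\sum_{y\in X,\,y\ne x}|K_\kappa(x-y)|\lesssim\frac{s^p}{\kappa\delta_X};$$ that is, for no $p<2/3$ is there a constant $C$ such that this estimate holds with constant $C$ for all $s\ge2$, all $s$-point sets $X\subset B_1(0)$ and all $\kappa>0$.
   Context: $\delta_X$ is the minimum distance between distinct points of $X$; $K_\kappa(h)=\frac{\sin(\kappa|h|)}{\kappa|h|}$ for $h\in\mathbb R^3\setminus\{0\}$, $K_\kappa(0)=1$. $A\asymp B$ means $A\le CB$ and $B\le CA$ for an absolute constant $C$. *)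

theory Defs
  imports "HOL-Analysis.Analysis"
begin

text \<open>The minimum is over a finite nonempty set, as it should be, only when \<open>X\<close> is finite
  with at least two points.\<close>

definition min_sep :: "(real ^ 3) set \<Rightarrow> real" where
  "min_sep X = Min {dist x y | x y. x \<in> X \<and> y \<in> X \<and> x \<noteq> y}"

definition helmholtz_kernel :: "real \<Rightarrow> real ^ 3 \<Rightarrow> real" where
  "helmholtz_kernel \<kappa> h = (if h = 0 then 1 else sin (\<kappa> * norm h) / (\<kappa> * norm h))"

definition max_offdiag_sum :: "real \<Rightarrow> (real ^ 3) set \<Rightarrow> real" where
  "max_offdiag_sum \<kappa> X =
     Max ((\<lambda>x. \<Sum>y\<in>X - {x}. \<bar>helmholtz_kernel \<kappa> (x - y)\<bar>) ` X)"

end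

(* The points are the cubic grid {0,...,n-1}^3 scaled by 1/(3n), so s = n^3, the separation is
   1/(3n), and at the corner 0 the sum is the sum of |sin (t |v|)| / (t |v|) over nonzero integer
   grid points v, with t = kappa * delta.  Since |sin| >= sin^2 and sin^2 has mean 1/2, some t in
   [n^2, 2 n^2] makes this comparable to the sum of 1 / (t |v|), which is at least a constant
   because there are about n^3 terms, each of order n^(-3).  As t is of order s^(2/3), these
   examples rule out every smaller exponent. *)

theory Submission
  imports Defs
begin

text \<open>One \<open>t\<close> has to serve all frequencies \<open>r i\<close> at once, so the
  whole weighted sum is averaged over the interval from \<open>T\<close> to \<open>2 * T\<close>.
  The mean value theorem, applied to the antiderivative \<open>F\<close>, gives a point where the
  sum equals its average. That average is at least a quarter of the total weight, since no frequency
  is below 1 and the interval is long enough for the oscillating parts not to matter.\<close>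

lemma exists_large_sum_sin_squared:
  fixes r :: "'a \<Rightarrow> real" and T :: real
  assumes r: "\<And>i. i \<in> I \<Longrightarrow> 1 \<le> r i" and T: "2 \<le> T"
  shows "\<exists>t. T < t \<and> t < 2 * T \<and> (\<Sum>i\<in>I. 1 / r i) / 4 \<le> (\<Sum>i\<in>I. (sin (t * r i))\<^sup>2 / r i)"
proof -
  define F where "F t = (\<Sum>i\<in>I. (t / 2 - sin (2 * (t * r i)) / (4 * r i)) / r i)" for t
  have deriv: "(F has_real_derivative (\<Sum>i\<in>I. (sin (t * r i))\<^sup>2 / r i)) (at t)" for t
    unfolding F_def
  proof (rule DERIV_sum)
    fix i assume "i \<in> I"
    hence nz: "r i \<noteq> 0" using r[of i] by auto
    have "((\<lambda>t. (t / 2 - sin (2 * (t * r i)) / (4 * r i)) / r i) has_real_derivative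
            (1 / 2 - cos (2 * (t * r i)) * (2 * r i) / (4 * r i)) / r i) (at t)"
      using nz by (auto intro!: derivative_eq_intros)
    moreover have "1 / 2 - cos (2 * (t * r i)) * (2 * r i) / (4 * r i) = (sin (t * r i))\<^sup>2"
      unfolding cos_double_sin using nz by (simp add: field_simps)
    ultimately show "((\<lambda>t. (t / 2 - sin (2 * (t * r i)) / (4 * r i)) / r i) has_real_derivative
        (sin (t * r i))\<^sup>2 / r i) (at t)" by simp
  qed
  have "T < 2 * T" using T by simp
  then obtain t where t: "T < t" "t < 2 * T"
    and mvt: "F (2 * T) - F T = (2 * T - T) * (\<Sum>i\<in>I. (sin (t * r i))\<^sup>2 / r i)"
    using MVT2[of T "2 * T" F "\<lambda>t. \<Sum>i\<in>I. (sin (t * r i))\<^sup>2 / r i"] deriv by blast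
  have "T * ((\<Sum>i\<in>I. 1 / r i) / 4) = (\<Sum>i\<in>I. (T / 4) / r i)"
    by (simp add: sum_divide_distrib sum_distrib_left mult.commute)
  also have "\<dots> \<le> (\<Sum>i\<in>I. (2 * T / 2 - sin (2 * (2 * T * r i)) / (4 * r i)) / r i
                        - (T / 2 - sin (2 * (T * r i)) / (4 * r i)) / r i)"
  proof (rule sum_mono)
    fix i assume "i \<in> I"
    hence ri: "1 \<le> r i" by (rule r)
    have bound: "\<bar>sin u / (4 * r i)\<bar> \<le> 1 / 4" for u
    proof -
      have "\<bar>sin u\<bar> \<le> 1" by simp
      also have "1 \<le> r i" by (rule ri)
      finally show ?thesis using ri by (simp add: abs_mult field_simps)
    qed
    \<comment> \<open>The linear parts contribute T/2 and the two boundary terms cost at most 1/4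
      each; T/2 - 1/2 is at least T/4 because T is at least 2.\<close>
    have "T / 4 \<le> (2 * T / 2 - sin (2 * (2 * T * r i)) / (4 * r i))
                    - (T / 2 - sin (2 * (T * r i)) / (4 * r i))"
      using bound[of "2 * (2 * T * r i)"] bound[of "2 * (T * r i)"] T by linarith
    moreover have "0 \<le> r i" using ri by simp
    ultimately have "(T / 4) / r i \<le> ((2 * T / 2 - sin (2 * (2 * T * r i)) / (4 * r i))
                    - (T / 2 - sin (2 * (T * r i)) / (4 * r i))) / r i"
      by (rule divide_right_mono)
    thus "(T / 4) / r i \<le> (2 * T / 2 - sin (2 * (2 * T * r i)) / (4 * r i)) / r i
                        - (T / 2 - sin (2 * (T * r i)) / (4 * r i)) / r i"
      by (simp only: diff_divide_distrib)
  qed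
  also have "\<dots> = F (2 * T) - F T" by (simp add: F_def sum_subtractf)
  also have "\<dots> = T * (\<Sum>i\<in>I. (sin (t * r i))\<^sup>2 / r i)" using mvt by simp
  finally show ?thesis using t T by auto
qed

definition integer_cube :: "nat \<Rightarrow> (real ^ 'd) set" where
  "integer_cube n = {v. \<forall>i. v $ i \<in> real ` {..<n}}"

text \<open>Reduces finiteness and counting of the grid to those of a finite product of
  sets.\<close>

lemma integer_cube_eq_image:
  "integer_cube n = vec_lambda ` (\<Pi>\<^sub>E i\<in>UNIV. real ` {..<n})"
proof -
  have "v \<in> vec_lambda ` (\<Pi>\<^sub>E i\<in>UNIV. real ` {..<n})" if "v \<in> integer_cube n" for v :: "real ^ 'd"
    by (rule image_eqI[where x = "vec_nth v"]) (use that in \<open>auto simp: integer_cube_def PiE_def\<close>)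
  thus ?thesis by (auto simp: integer_cube_def PiE_iff)
qed

lemma finite_integer_cube: "finite (integer_cube n)"
  unfolding integer_cube_eq_image by (intro finite_imageI finite_PiE) auto

lemma card_integer_cube: "card (integer_cube n :: (real ^ 'd) set) = n ^ CARD('d)"
proof -
  have "inj_on vec_lambda (\<Pi>\<^sub>E i\<in>(UNIV :: 'd set). real ` {..<n})"
    by (rule inj_onI) (metis vec_lambda_inverse UNIV_I)
  hence "card (integer_cube n :: (real ^ 'd) set) = card (\<Pi>\<^sub>E i\<in>(UNIV :: 'd set). real ` {..<n})"
    unfolding integer_cube_eq_image by (rule card_image)
  also have "\<dots> = n ^ CARD('d)" by (simp add: card_PiE card_image)
  finally show ?thesis .
qed

text \<open>Obtained by comparison with the l1 norm. The factor is the dimension instead of its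
  square root; this loss only affects constants.\<close>

lemma norm_integer_cube_le:
  fixes v :: "real ^ 'd"
  assumes "v \<in> integer_cube n"
  shows "norm v \<le> CARD('d) * (real n - 1)"
proof -
  have "\<bar>v $ i\<bar> \<le> real n - 1" for i
  proof -
    obtain k where "v $ i = real k" "k < n" using assms by (auto simp: integer_cube_def)
    thus ?thesis by simp
  qed
  hence "(\<Sum>i\<in>UNIV. \<bar>v $ i\<bar>) \<le> (\<Sum>i\<in>(UNIV :: 'd set). real n - 1)" by (intro sum_mono) auto
  thus ?thesis using norm_le_l1_cart[of v] by simp
qed

text \<open>Distinct grid points differ in some coordinate, and there by a nonzero integer.\<close>

lemma dist_integer_cube_ge_1:
  assumes "v \<in> integer_cube n" "w \<in> integer_cube n" "v \<noteq> w"
  shows "1 \<le> dist v w"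
proof -
  obtain i where i: "v $ i \<noteq> w $ i" using assms(3) by (auto simp: vec_eq_iff)
  obtain k l where kl: "v $ i = real k" "w $ i = real l"
    using assms(1,2) by (fastforce simp: integer_cube_def)
  have "1 \<le> \<bar>real k - real l\<bar>" using i kl by (auto simp: abs_if)
  also have "\<dots> = \<bar>(v - w) $ i\<bar>" by (simp add: kl)
  also have "\<dots> \<le> dist v w" unfolding dist_norm by (rule component_le_norm_cart)
  finally show ?thesis .
qed

lemma zero_in_integer_cube: "0 < n \<Longrightarrow> 0 \<in> integer_cube n"
  by (auto simp: integer_cube_def intro!: image_eqI[where x = 0])

lemma axis_in_integer_cube: "2 \<le> n \<Longrightarrow> axis i 1 \<in> integer_cube n"
  by (auto simp: integer_cube_def axis_def intro: image_eqI[where x = 0] image_eqI[where x = 1])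

text \<open>The minimum is attained by the origin and a scaled unit vector, which lies in the grid
  once \<open>n\<close> is at least 2.\<close>

lemma min_sep_scaled_integer_cube:
  assumes d: "0 < d" and n: "2 \<le> n"
  shows "min_sep ((*\<^sub>R) d ` integer_cube n) = d"
proof -
  define X :: "(real ^ 3) set" where "X = (*\<^sub>R) d ` integer_cube n"
  have "finite X" by (simp add: X_def finite_integer_cube)
  hence fin: "finite {dist x y | x y. x \<in> X \<and> y \<in> X \<and> x \<noteq> y}"
    by (intro finite_subset[OF _ finite_imageI[of "X \<times> X" "case_prod dist"]]) auto
  have "d \<le> e" if "e \<in> {dist x y | x y. x \<in> X \<and> y \<in> X \<and> x \<noteq> y}" for e
  proof -
    from that obtain v w :: "real ^ 3" where vw: "v \<in> integer_cube n" "w \<in> integer_cube n" "v \<noteq> w"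
      and e: "e = dist (d *\<^sub>R v) (d *\<^sub>R w)" unfolding X_def by blast
    have "e = d * dist v w" using d by (simp add: e dist_norm flip: scaleR_diff_right)
    thus ?thesis using d dist_integer_cube_ge_1[OF vw] by simp
  qed
  moreover have "d \<in> {dist x y | x y. x \<in> X \<and> y \<in> X \<and> x \<noteq> y}"
  proof -
    have "d *\<^sub>R axis 1 1 \<in> X" "0 \<in> X"
      using n axis_in_integer_cube[of n] zero_in_integer_cube[of n] by (force simp: X_def)+
    moreover have "dist (d *\<^sub>R axis 1 1 :: real ^ 3) 0 = d" using d by simp
    moreover have "d *\<^sub>R axis 1 1 \<noteq> (0 :: real ^ 3)" using d by simp
    ultimately show ?thesis by force
  qed
  ultimately show ?thesis unfolding min_sep_def X_def[symmetric] using fin by (intro Min_eqI) auto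
qed

text \<open>Both halves of the theorem rest on this family of examples: the first reads it off
  directly, the second tests the supposed estimate on it.\<close>

lemma exists_large_offdiag_sum:
  fixes n :: nat
  assumes n: "2 \<le> n"
  shows "\<exists>(X :: (real ^ 3) set) \<kappa>. finite X \<and> card X = n ^ 3 \<and> X \<subseteq> ball 0 1 \<and> \<kappa> > 0 \<and>
           real n ^ 2 \<le> \<kappa> * min_sep X \<and> \<kappa> * min_sep X \<le> 2 * real n ^ 2 \<and>
           max_offdiag_sum \<kappa> X \<ge> 1 / 48"
proof -
  define G :: "(real ^ 3) set" where "G = integer_cube n"
  \<comment> \<open>Grid vectors have norm at most 3(n - 1), so this scale puts them strictly inside
    the unit ball.\<close>
  define d where "d = 1 / (3 * real n)"
  define X where "X = (*\<^sub>R) d ` G"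
  have d: "0 < d" using n by (simp add: d_def)
  have fG: "finite G" and cG: "card G = n ^ 3" and z: "0 \<in> G"
    using n by (simp_all add: G_def finite_integer_cube card_integer_cube zero_in_integer_cube)
  have inj: "inj_on ((*\<^sub>R) d) A" for A :: "(real ^ 3) set" using d by (auto simp: inj_on_def)
  have X: "finite X" "card X = n ^ 3" "0 \<in> X"
    using fG cG z inj by (auto simp: X_def card_image intro: image_eqI[where x = 0])
  have norm_le: "norm v \<le> 3 * (real n - 1)" if "v \<in> G" for v
    using norm_integer_cube_le[of v n] that by (simp add: G_def)
  have norm_ge: "1 \<le> norm v" if "v \<in> G - {0}" for v
    using dist_integer_cube_ge_1[of v n 0] that z by (simp add: G_def)
  have ball: "X \<subseteq> ball 0 1"
  proof
    fix x assume "x \<in> X"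
    then obtain v where v: "v \<in> G" "x = d *\<^sub>R v" by (auto simp: X_def)
    have "norm x = norm v / (3 * real n)" using n by (simp add: v d_def)
    also have "\<dots> < 1" using norm_le[OF v(1)] n by simp
    finally show "x \<in> ball 0 1" by simp
  qed
  have n2: "2 \<le> real n ^ 2" using power_mono[of 2 "real n" 2] n by simp
  obtain t where t: "real n ^ 2 < t" "t < 2 * real n ^ 2"
    and sum_ge: "(\<Sum>v\<in>G - {0}. 1 / norm v) / 4 \<le> (\<Sum>v\<in>G - {0}. (sin (t * norm v))\<^sup>2 / norm v)"
    using exists_large_sum_sin_squared[of "G - {0}" norm "real n ^ 2"] norm_ge n2 by blast
  have t0: "0 < t" using t(1) n2 by linarith
  \<comment> \<open>Undoes the scaling: the phase at a point \<open>d *\<^sub>R v\<close> is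
    \<open>t * norm v\<close>, and the separation \<open>d\<close> gives \<kappa> times separation
    equal to \<open>t\<close>.\<close>
  define \<kappa> where "\<kappa> = t / d"
  have \<kappa>0: "\<kappa> > 0" using t0 d by (simp add: \<kappa>_def)
  have \<kappa>d: "\<kappa> * min_sep X = t"
    using d n by (simp add: X_def G_def min_sep_scaled_integer_cube \<kappa>_def)
  \<comment> \<open>Dropping the origin leaves at least half of the n^3 points. Each has norm at
    most 3n, so the inverse norms add up to at least (n^3 / 2) / (3n) = n^2 / 6.\<close>
  have "8 \<le> real n ^ 3" using power_mono[of 2 "real n" 3] n by simp
  hence "real n ^ 3 / 2 \<le> real n ^ 3 - 1" by simp
  also have "\<dots> = real (card (G - {0}))" using z fG cG n by (simp add: of_nat_diff)
  finally have cnt: "real n ^ 3 / 2 \<le> real (card (G - {0}))" .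
  have "real n ^ 2 / 6 = (real n ^ 3 / 2) * (1 / (3 * real n))"
    using n by (simp add: field_simps power2_eq_square power3_eq_cube)
  also have "\<dots> \<le> real (card (G - {0})) * (1 / (3 * real n))"
    using cnt by (intro mult_right_mono) auto
  also have "\<dots> = (\<Sum>v\<in>G - {0}. 1 / (3 * real n))" by simp
  also have "\<dots> \<le> (\<Sum>v\<in>G - {0}. 1 / norm v)"
  proof (rule sum_mono)
    fix v assume v: "v \<in> G - {0}"
    have "norm v \<le> 3 * real n" using norm_le[of v] v by simp
    moreover have "0 < norm v" using v by simp
    ultimately show "1 / (3 * real n) \<le> 1 / norm v" using n by (intro divide_left_mono mult_pos_pos) auto
  qed
  finally have inv_norms: "real n ^ 2 / 6 \<le> (\<Sum>v\<in>G - {0}. 1 / norm v)" .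
  \<comment> \<open>The constant is 1/6 from the inverse norms, times 1/4 from the averaging, times
    1/2 because \<open>t\<close> may be almost 2n^2.\<close>
  have "1 / 48 * t \<le> real n ^ 2 / 24" using t(2) by simp
  also have "\<dots> \<le> (\<Sum>v\<in>G - {0}. (sin (t * norm v))\<^sup>2 / norm v)" using inv_norms sum_ge by linarith
  finally have "1 / 48 \<le> (\<Sum>v\<in>G - {0}. (sin (t * norm v))\<^sup>2 / norm v) / t"
    using t0 by (simp add: pos_le_divide_eq)
  also have "\<dots> = (\<Sum>v\<in>G - {0}. (sin (t * norm v))\<^sup>2 / (t * norm v))"
    by (simp add: sum_divide_distrib mult.commute)
  also have "\<dots> \<le> (\<Sum>v\<in>G - {0}. \<bar>helmholtz_kernel \<kappa> (0 - d *\<^sub>R v)\<bar>)"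
  proof (rule sum_mono)
    fix v assume v: "v \<in> G - {0}"
    have "(sin (t * norm v))\<^sup>2 \<le> \<bar>sin (t * norm v)\<bar>"
      using mult_left_le[of "\<bar>sin (t * norm v)\<bar>" "\<bar>sin (t * norm v)\<bar>"]
      by (simp add: power2_eq_square flip: abs_mult)
    hence "(sin (t * norm v))\<^sup>2 / (t * norm v) \<le> \<bar>sin (t * norm v)\<bar> / (t * norm v)"
      using t0 by (intro divide_right_mono) auto
    also have "\<dots> = \<bar>helmholtz_kernel \<kappa> (0 - d *\<^sub>R v)\<bar>"
      using v d t0 by (simp add: helmholtz_kernel_def \<kappa>_def abs_mult)
    finally show "(sin (t * norm v))\<^sup>2 / (t * norm v) \<le> \<bar>helmholtz_kernel \<kappa> (0 - d *\<^sub>R v)\<bar>" .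
  qed
  also have "\<dots> = (\<Sum>y\<in>(*\<^sub>R) d ` (G - {0}). \<bar>helmholtz_kernel \<kappa> (0 - y)\<bar>)"
    by (simp add: sum.reindex[OF inj])
  also have "(*\<^sub>R) d ` (G - {0}) = X - {0}" using d by (auto simp: X_def)
  \<comment> \<open>The maximum is at least its value at the corner 0.\<close>
  also have "(\<Sum>y\<in>X - {0}. \<bar>helmholtz_kernel \<kappa> (0 - y)\<bar>) \<le> max_offdiag_sum \<kappa> X"
    unfolding max_offdiag_sum_def using X by (intro Max_ge finite_imageI image_eqI[where x = 0] refl)
  finally show ?thesis using X ball \<kappa>0 \<kappa>d t by (intro exI[of _ X] exI[of _ \<kappa>]) auto
qed

text \<open>Translates powers of s = n^3 into powers of n: the exponent 2/3 becomes 2, which matches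
  the size of \<kappa> times separation.\<close>

lemma cube_powr: "real (n ^ 3) powr p = real n powr (3 * p)"
proof -
  have "real (n ^ 3) powr p = real n powr p * real n powr p * real n powr p"
    by (simp add: powr_mult power3_eq_cube)
  thus ?thesis by (simp flip: powr_add)
qed

theorem propositionD1:
  shows "(\<exists>c>0. \<exists>C>0. \<forall>N::nat. \<exists>s\<ge>N. \<exists>(X :: (real ^ 3) set) (\<kappa> :: real).
            finite X \<and> card X = s \<and> X \<subseteq> ball 0 1 \<and> \<kappa> > 0 \<and>
            \<kappa> * min_sep X \<le> C * real s powr (2 / 3) \<and>
            real s powr (2 / 3) \<le> C * (\<kappa> * min_sep X) \<and>
            max_offdiag_sum \<kappa> X \<ge> c)
       \<and> (\<forall>p::real. p < 2 / 3 \<longrightarrow>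
            \<not> (\<exists>C::real. \<forall>s\<ge>(2::nat). \<forall>(X :: (real ^ 3) set) (\<kappa> :: real).
                  finite X \<and> card X = s \<and> X \<subseteq> ball 0 1 \<and> \<kappa> > 0 \<longrightarrow>
                  max_offdiag_sum \<kappa> X \<le> C * (real s powr p / (\<kappa> * min_sep X))))"
proof (intro conjI allI impI notI)
  show "\<exists>c>0. \<exists>C>0. \<forall>N::nat. \<exists>s\<ge>N. \<exists>(X :: (real ^ 3) set) (\<kappa> :: real).
            finite X \<and> card X = s \<and> X \<subseteq> ball 0 1 \<and> \<kappa> > 0 \<and>
            \<kappa> * min_sep X \<le> C * real s powr (2 / 3) \<and>
            real s powr (2 / 3) \<le> C * (\<kappa> * min_sep X) \<and>
            max_offdiag_sum \<kappa> X \<ge> c"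
  proof (rule exI[of _ "1 / 48"], rule conjI, simp, rule exI[of _ 2], rule conjI, simp, rule allI)
    fix N :: nat
    \<comment> \<open>Large enough both for the construction and for n^3 to reach
      \<open>N\<close>.\<close>
    define n where "n = max 2 N"
    have n: "2 \<le> n" "N \<le> n" by (auto simp: n_def)
    obtain X :: "(real ^ 3) set" and \<kappa> :: real where X: "finite X" "card X = n ^ 3" "X \<subseteq> ball 0 1"
      "\<kappa> > 0" "real n ^ 2 \<le> \<kappa> * min_sep X" "\<kappa> * min_sep X \<le> 2 * real n ^ 2"
      "max_offdiag_sum \<kappa> X \<ge> 1 / 48"
      using exists_large_offdiag_sum[OF n(1)] by blast
    have powr: "real (n ^ 3) powr (2 / 3) = real n ^ 2" using n by (simp only: cube_powr) simp
    have "N \<le> n ^ 3" using n self_le_power[of n 3] by simp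
    moreover have "real n ^ 2 \<le> 2 * (\<kappa> * min_sep X)"
      using X(5) zero_le_power2[of "real n"] by linarith
    ultimately show "\<exists>s\<ge>N. \<exists>(X :: (real ^ 3) set) (\<kappa> :: real).
            finite X \<and> card X = s \<and> X \<subseteq> ball 0 1 \<and> \<kappa> > 0 \<and>
            \<kappa> * min_sep X \<le> 2 * real s powr (2 / 3) \<and>
            real s powr (2 / 3) \<le> 2 * (\<kappa> * min_sep X) \<and>
            max_offdiag_sum \<kappa> X \<ge> 1 / 48"
      using X by (intro exI[of _ "n ^ 3"] conjI exI[of _ X] exI[of _ \<kappa>]) (simp_all only: powr)
  qed
next
  fix p :: real
  assume p: "p < 2 / 3"
  assume "\<exists>C::real. \<forall>s\<ge>(2::nat). \<forall>(X :: (real ^ 3) set) (\<kappa> :: real).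
            finite X \<and> card X = s \<and> X \<subseteq> ball 0 1 \<and> \<kappa> > 0 \<longrightarrow>
            max_offdiag_sum \<kappa> X \<le> C * (real s powr p / (\<kappa> * min_sep X))"
  then obtain C :: real where bound: "\<forall>s\<ge>(2::nat). \<forall>(X :: (real ^ 3) set) (\<kappa> :: real).
            finite X \<and> card X = s \<and> X \<subseteq> ball 0 1 \<and> \<kappa> > 0 \<longrightarrow>
            max_offdiag_sum \<kappa> X \<le> C * (real s powr p / (\<kappa> * min_sep X))" ..
  \<comment> \<open>On the grid examples the supposed estimate bounds a fixed positive constant by a
    multiple of n^(3p) / n^2.\<close>
  have lower: "1 / 48 \<le> \<bar>C\<bar> * real n powr (3 * p - 2)" if n: "2 \<le> n" for n :: nat
  proof -
    obtain X :: "(real ^ 3) set" and \<kappa> :: real where X: "finite X" "card X = n ^ 3" "X \<subseteq> ball 0 1"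
      "\<kappa> > 0" "real n ^ 2 \<le> \<kappa> * min_sep X" "max_offdiag_sum \<kappa> X \<ge> 1 / 48"
      using exists_large_offdiag_sum[OF n] by blast
    have n0: "0 < real n" using n by simp
    hence pos: "0 < \<kappa> * min_sep X" using X(5) by (meson less_le_trans zero_less_power)
    have "2 \<le> n ^ 3" using n self_le_power[of n 3] by linarith
    hence "1 / 48 \<le> C * (real (n ^ 3) powr p / (\<kappa> * min_sep X))"
      using bound[rule_format, of "n ^ 3" X \<kappa>] X by linarith
    \<comment> \<open>The sign of \<open>C\<close> is unknown; with its absolute value the
      denominator may be lowered to n^2.\<close>
    also have "\<dots> \<le> \<bar>C\<bar> * (real (n ^ 3) powr p / (\<kappa> * min_sep X))"
      using pos by (intro mult_right_mono) auto
    also have "\<dots> \<le> \<bar>C\<bar> * (real (n ^ 3) powr p / real n ^ 2)"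
      using X(5) n0 pos by (intro mult_left_mono divide_left_mono) auto
    also have "real (n ^ 3) powr p / real n ^ 2 = real n powr (3 * p - 2)"
      using n0 by (simp only: cube_powr powr_diff) simp
    finally show ?thesis .
  qed
  \<comment> \<open>The exponent 3p - 2 is negative exactly because p < 2/3, so the right-hand side
    of \<open>lower\<close> tends to 0 and cannot stay above 1/48.\<close>
  have "((\<lambda>n. real n powr (3 * p - 2)) \<longlongrightarrow> 0) sequentially"
    using p by (intro tendsto_neg_powr filterlim_real_sequentially) auto
  hence "((\<lambda>n. \<bar>C\<bar> * real n powr (3 * p - 2)) \<longlongrightarrow> \<bar>C\<bar> * 0) sequentially"
    by (intro tendsto_mult tendsto_const)
  moreover have "\<forall>\<^sub>F n in sequentially. 1 / 48 \<le> \<bar>C\<bar> * real n powr (3 * p - 2)"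
    using eventually_ge_at_top[of "2 :: nat"] by eventually_elim (rule lower)
  ultimately have "1 / 48 \<le> \<bar>C\<bar> * 0" by (intro tendsto_lowerbound) auto
  thus False by simp
qed

end
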